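(* Let $S$ be an HL semigroup. For every finite coloring of $S$, the configuration $\{a,b,ab,b(a+1)\}$ is monochromatic near zero: that is, for every $r\in\mathbb N$, every partition $S=\bigcup_{i=1}^r A_i$ and every $\epsilon>0$, there exist $a,b\in S$ and $k\in\{1,\dots,r\}$ such that $a,b,ab,b(a+1)$ all belong to $A_k\cap(0,\epsilon)$.
   Context: A dense subsemigroup $S$ of $((0,\infty),+)$ is called an HL semigroup if $S\cap(0,1)$ is a subsemigroup of $((0,1),\cdot)$ and for each $y\in S\cap(0,1)$ and each $x\in S$, both $x/y\in S$ and $yx\in S$. A configuration is "monochromatic near zero" if for every finite coloring and every $\epsilon>0$ it can be found inside one color class and inside $(0,\epsilon)$. *)

theory Defs
  imports "HOL-Analysis.Analysis" "HOL-Library.Disjoint_Sets"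
begin

text \<open>Nonemptiness of \<open>S \<inter> (0,1)\<close> is not listed separately: it follows from density.\<close>

definition HL_semigroup :: "real set \<Rightarrow> bool" where
  "HL_semigroup S \<longleftrightarrow>
     S \<subseteq> {0<..} \<and>
     (\<forall>x\<in>S. \<forall>y\<in>S. x + y \<in> S) \<and>
     {0<..} \<subseteq> closure S \<and>
     (\<forall>x\<in>S \<inter> {0<..<1}. \<forall>y\<in>S \<inter> {0<..<1}. x * y \<in> S \<inter> {0<..<1}) \<and>
     (\<forall>y\<in>S \<inter> {0<..<1}. \<forall>x\<in>S. x / y \<in> S \<and> y * x \<in> S)"

end

theory Submission
  imports Defs
begin

text \<open>
  Writing \<open>b = v / t\<close> and \<open>a = u / v\<close>, the configuration becomes
  \<open>v / t\<close>, \<open>u / v\<close>, \<open>u / t\<close>, \<open>(v + u) / t\<close>, so it suffices to colour the pair \<open>(t, v)\<close> by the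
  colour of \<open>v / t\<close>. By the Ellis--Numakura argument there is an additively idempotent ultrafilter
  \<open>p\<close> on \<open>S\<close> converging to \<open>0\<close>. Some colour \<open>k\<close> is the colour of \<open>v / t\<close> for \<open>p\<close>-many \<open>t\<close> and, given
  \<open>t\<close>, for \<open>p\<close>-many \<open>v\<close>; idempotence lets one choose \<open>t\<close>, \<open>v\<close>, \<open>u\<close> successively so that
  \<open>(v + u) / t\<close> has colour \<open>k\<close> as well.
\<close>

section \<open>Ultrafilters\<close>

definition ultrafilter :: "'a filter \<Rightarrow> bool" where
  "ultrafilter F \<longleftrightarrow> F \<noteq> bot \<and> (\<forall>P. eventually P F \<or> eventually (\<lambda>x. \<not> P x) F)"

lemma ultrafilter_neq_bot: "ultrafilter F \<Longrightarrow> F \<noteq> bot"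
  by (simp add: ultrafilter_def)

lemma ultrafilter_eventually_not_iff:
  assumes "ultrafilter F"
  shows "eventually (\<lambda>x. \<not> P x) F \<longleftrightarrow> \<not> eventually P F"
  using assms unfolding ultrafilter_def
  by (metis eventually_frequently not_eventually)

text \<open>Ultrafilters are minimal proper filters: an event of \<open>G\<close> missing from
  \<open>F\<close> would have its complement in \<open>F\<close>, hence in \<open>G\<close>.\<close>

lemma ultrafilter_eq_of_le:
  assumes "ultrafilter F" "G \<le> F" "G \<noteq> bot"
  shows "G = F"
proof (rule antisym)
  show "F \<le> G"
  proof (rule filter_leI)
    fix P assume P: "eventually P G"
    show "eventually P F"
    proof (rule ccontr)
      assume "\<not> eventually P F"
      then have "eventually (\<lambda>x. \<not> P x) G"
        using assms(1,2) by (auto simp: ultrafilter_eventually_not_iff intro: filter_leD)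
      with P have "eventually (\<lambda>x. False) G"
        by eventually_elim simp
      with assms(3) show False by (simp add: trivial_limit_def)
    qed
  qed
qed fact

lemma ultrafilter_eventually_bex:
  assumes "ultrafilter F" "finite I" "eventually (\<lambda>x. \<exists>i\<in>I. P i x) F"
  shows "\<exists>i\<in>I. eventually (P i) F"
proof (rule ccontr)
  assume "\<not> (\<exists>i\<in>I. eventually (P i) F)"
  then have "\<forall>i\<in>I. eventually (\<lambda>x. \<not> P i x) F"
    using assms(1) by (simp add: ultrafilter_eventually_not_iff)
  then have "eventually (\<lambda>x. \<forall>i\<in>I. \<not> P i x) F"
    using assms(2) by (simp add: eventually_ball_finite)
  with assms(3) have "eventually (\<lambda>x. False) F"
    by eventually_elim blast
  with assms(1) show False by (simp add: ultrafilter_def trivial_limit_def)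
qed

text \<open>A chain is a filter base, so every event of its infimum already belongs to one member.
  This compactness argument supplies the lower bounds for Zorn.\<close>

lemma Inf_chain_filter_neq_bot:
  assumes "C \<noteq> {}" "\<And>F. F \<in> C \<Longrightarrow> F \<noteq> bot" "\<And>F G. F \<in> C \<Longrightarrow> G \<in> C \<Longrightarrow> F \<le> G \<or> G \<le> F"
  shows "Inf C \<noteq> (bot :: 'a filter)"
proof -
  have "\<exists>H\<in>C. H \<le> inf F G" if "F \<in> C" "G \<in> C" for F G
    using assms(3)[OF that] that by (metis inf.absorb1 inf.absorb2 order_refl)
  then have "eventually P (Inf C) \<longleftrightarrow> (\<exists>F\<in>C. eventually P F)" for P
    using eventually_Inf_base[OF assms(1)] by blast
  with assms(2) show ?thesis by (simp add: trivial_limit_def)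
qed

text \<open>Zorn's lemma for the reversed order. A trivial \<open>Q\<close> will give ultrafilters;
  \<open>add_closed_filter\<close> will give minimal closed subsemigroups.\<close>

lemma minimal_filter_exists:
  fixes F :: "'a filter"
  assumes "Q F" "F \<noteq> bot" and Inf: "\<And>C. C \<noteq> {} \<Longrightarrow> (\<And>G. G \<in> C \<Longrightarrow> Q G) \<Longrightarrow> Q (Inf C)"
  obtains M where "Q M" "M \<noteq> bot" "M \<le> F"
    "\<And>G. Q G \<Longrightarrow> G \<noteq> bot \<Longrightarrow> G \<le> M \<Longrightarrow> G = M"
proof -
  define A where "A = {G. Q G \<and> G \<noteq> bot \<and> G \<le> F}"
  have "\<exists>M\<in>A. \<forall>G\<in>A. M \<ge> G \<longrightarrow> G = M"
  proof (rule predicate_Zorn)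
    show "partial_order_on A (relation_of (\<ge>) A)"
      by (auto simp: partial_order_on_def preorder_on_def refl_on_def trans_def antisym_def
          relation_of_def)
  next
    fix C assume C: "C \<in> Chains (relation_of (\<ge>) A)"
    then have CA: "C \<subseteq> A" and chain: "\<And>G H. G \<in> C \<Longrightarrow> H \<in> C \<Longrightarrow> G \<le> H \<or> H \<le> G"
      by (auto simp: Chains_def relation_of_def)
    show "\<exists>U\<in>A. \<forall>G\<in>C. G \<ge> U"
    proof (cases "C = {}")
      case True
      then show ?thesis using assms(1,2) by (auto simp: A_def)
    next
      case False
      have "Inf C \<noteq> bot"
        using Inf_chain_filter_neq_bot[OF False _ chain] CA by (auto simp: A_def)
      moreover have "Q (Inf C)"
        using Inf[OF False] CA by (auto simp: A_def)
      moreover have "Inf C \<le> F"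
        using False CA by (auto simp: A_def intro: Inf_lower2)
      ultimately have "Inf C \<in> A" by (simp add: A_def)
      then show ?thesis by (auto intro: Inf_lower)
    qed
  qed
  then obtain M where "M \<in> A" "\<And>G. G \<in> A \<Longrightarrow> G \<le> M \<Longrightarrow> G = M" by blast
  then show thesis
    by (intro that[of M]) (auto simp: A_def)
qed

lemma ultrafilter_exists_le:
  assumes "F \<noteq> bot"
  obtains U where "ultrafilter U" "U \<le> F"
proof -
  obtain U where U: "U \<noteq> bot" "U \<le> F" and min: "\<And>G. G \<noteq> bot \<Longrightarrow> G \<le> U \<Longrightarrow> G = U"
    using minimal_filter_exists[of "\<lambda>_. True" F] assms by metis
  \<comment> \<open>Adjoin \<open>P\<close> to \<open>U\<close>: either this is inconsistent, so the
    complement is an event, or minimality shows that \<open>P\<close> was an event already.\<close>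
  have "eventually P U \<or> eventually (\<lambda>x. \<not> P x) U" for P
  proof (cases "inf U (principal {x. P x}) = bot")
    case True
    then have "eventually (\<lambda>x. \<not> P x) U"
      by (simp add: trivial_limit_def eventually_inf_principal)
    then show ?thesis ..
  next
    case False
    then have "inf U (principal {x. P x}) = U" by (intro min) auto
    then have "U \<le> principal {x. P x}" by (metis inf.cobounded2)
    then show ?thesis by (simp add: le_principal)
  qed
  with U show thesis by (intro that) (auto simp: ultrafilter_def)
qed

text \<open>An event of \<open>G\<close> that is not one of \<open>F\<close> leaves room for an
  ultrafilter below \<open>F\<close> containing its complement. Hence filters can stand for closed
  sets of ultrafilters.\<close>

lemma filter_le_of_ultrafilters:
  assumes "\<And>U. ultrafilter U \<Longrightarrow> U \<le> F \<Longrightarrow> U \<le> G"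
  shows "F \<le> G"
proof (rule filter_leI, rule ccontr)
  fix P assume P: "eventually P G" "\<not> eventually P F"
  then have "inf F (principal {x. \<not> P x}) \<noteq> bot"
    by (simp add: trivial_limit_def eventually_inf_principal)
  then obtain U where U: "ultrafilter U" "U \<le> inf F (principal {x. \<not> P x})"
    by (rule ultrafilter_exists_le)
  then have "eventually P U" "eventually (\<lambda>x. \<not> P x) U"
    using assms[of U] P(1) by (auto simp: le_principal intro: filter_leD)
  then show False using U(1) by (simp add: ultrafilter_eventually_not_iff)
qed

section \<open>Addition of filters and idempotent ultrafilters\<close>

text \<open>On ultrafilters this is the addition of the Stone-Cech compactification, with the left
  summand quantified first.\<close>

definition filter_add :: "'a::semigroup_add filter \<Rightarrow> 'a filter \<Rightarrow> 'a filter" where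
  "filter_add F G = Abs_filter (\<lambda>P. eventually (\<lambda>x. eventually (\<lambda>y. P (x + y)) G) F)"

lemma eventually_filter_add:
  "eventually P (filter_add F G) \<longleftrightarrow> eventually (\<lambda>x. eventually (\<lambda>y. P (x + y)) G) F"
  unfolding filter_add_def
proof (rule eventually_Abs_filter, unfold_locales)
  fix P Q :: "'a \<Rightarrow> bool"
  assume "\<forall>\<^sub>F x in F. \<forall>\<^sub>F y in G. P (x + y)" "\<forall>\<^sub>F x in F. \<forall>\<^sub>F y in G. Q (x + y)"
  then show "\<forall>\<^sub>F x in F. \<forall>\<^sub>F y in G. P (x + y) \<and> Q (x + y)"
    by eventually_elim (rule eventually_conj)
next
  fix P Q :: "'a \<Rightarrow> bool"
  assume "\<forall>x. P x \<longrightarrow> Q x" "\<forall>\<^sub>F x in F. \<forall>\<^sub>F y in G. P (x + y)"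
  then show "\<forall>\<^sub>F x in F. \<forall>\<^sub>F y in G. Q (x + y)"
    by (auto elim!: eventually_mono)
qed simp

lemma filter_add_assoc: "filter_add (filter_add F G) H = filter_add F (filter_add G H)"
  by (simp add: filter_eq_iff eventually_filter_add add.assoc)

lemma filter_add_mono: "F \<le> F' \<Longrightarrow> G \<le> G' \<Longrightarrow> filter_add F G \<le> filter_add F' G'"
  unfolding le_filter_def eventually_filter_add by (meson eventually_mono)

lemma filter_add_neq_bot: "F \<noteq> bot \<Longrightarrow> G \<noteq> bot \<Longrightarrow> filter_add F G \<noteq> bot"
  by (simp add: trivial_limit_def eventually_filter_add)

text \<open>The residual of adding \<open>G\<close> on the right, as
  \<open>filter_add_le_iff\<close> confirms. It encodes the closed set of all \<open>q\<close> with
  \<open>filter_add q G \<le> F\<close>.\<close>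

definition filter_diff :: "'a::semigroup_add filter \<Rightarrow> 'a filter \<Rightarrow> 'a filter" where
  "filter_diff F G =
    Abs_filter (\<lambda>Q. \<exists>P. eventually P F \<and> (\<forall>x. eventually (\<lambda>y. P (x + y)) G \<longrightarrow> Q x))"

lemma eventually_filter_diff:
  "eventually Q (filter_diff F G) \<longleftrightarrow>
    (\<exists>P. eventually P F \<and> (\<forall>x. eventually (\<lambda>y. P (x + y)) G \<longrightarrow> Q x))"
  unfolding filter_diff_def
proof (rule eventually_Abs_filter, unfold_locales)
  fix Q R :: "'a \<Rightarrow> bool"
  assume "\<exists>P. eventually P F \<and> (\<forall>x. eventually (\<lambda>y. P (x + y)) G \<longrightarrow> Q x)"
    "\<exists>P. eventually P F \<and> (\<forall>x. eventually (\<lambda>y. P (x + y)) G \<longrightarrow> R x)"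
  then obtain P P' where "eventually P F" "\<forall>x. eventually (\<lambda>y. P (x + y)) G \<longrightarrow> Q x"
    "eventually P' F" "\<forall>x. eventually (\<lambda>y. P' (x + y)) G \<longrightarrow> R x"
    by blast
  then show "\<exists>P. eventually P F \<and> (\<forall>x. eventually (\<lambda>y. P (x + y)) G \<longrightarrow> Q x \<and> R x)"
    by (intro exI[of _ "\<lambda>x. P x \<and> P' x"]) (auto simp: eventually_conj_iff)
qed (auto intro: exI[of _ "\<lambda>_. True"])

lemma filter_add_le_iff: "filter_add F G \<le> H \<longleftrightarrow> F \<le> filter_diff H G"
  unfolding le_filter_def eventually_filter_add eventually_filter_diff
  by (meson eventually_mono)

text \<open>Addition on the right by an ultrafilter maps closed sets of ultrafilters to closed sets.\<close>

lemma ultrafilter_le_filter_addE: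
  assumes p: "ultrafilter p" and r: "ultrafilter r" "r \<le> filter_add F p"
  obtains q where "ultrafilter q" "q \<le> F" "filter_add q p = r"
proof -
  \<comment> \<open>Otherwise, for \<open>F\<close>-many \<open>x\<close>, the event
    \<open>P\<close> of \<open>r\<close> fails at \<open>x + y\<close> for \<open>p\<close>-many
    \<open>y\<close>, since \<open>p\<close> is an ultrafilter; then \<open>r\<close> would also
    contain the complement of \<open>P\<close>.\<close>
  have "inf F (filter_diff r p) \<noteq> bot"
  proof
    assume "inf F (filter_diff r p) = bot"
    then obtain B P where B: "eventually B F" and P: "eventually P r"
      and disj: "\<And>x. B x \<Longrightarrow> \<not> eventually (\<lambda>y. P (x + y)) p"
      unfolding trivial_limit_def eventually_inf eventually_filter_diff by blast
    have "eventually (\<lambda>x. \<not> P x) (filter_add F p)"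
      using B p unfolding eventually_filter_add
      by (auto simp: ultrafilter_eventually_not_iff disj elim: eventually_mono)
    then have "eventually (\<lambda>x. \<not> P x) r" using r(2) by (rule filter_leD[rotated])
    with P r(1) show False by (simp add: ultrafilter_eventually_not_iff)
  qed
  then obtain q where q: "ultrafilter q" "q \<le> inf F (filter_diff r p)"
    by (rule ultrafilter_exists_le)
  then have "filter_add q p \<le> r" by (simp add: filter_add_le_iff)
  then have "filter_add q p = r"
    using r(1) p q(1) by (intro ultrafilter_eq_of_le filter_add_neq_bot ultrafilter_neq_bot)
  with q show thesis by (intro that) auto
qed

text \<open>A filter stands for the closed set of ultrafilters below it; being closed under addition says
  that this set is a subsemigroup.\<close>

definition add_closed_filter :: "'a::semigroup_add filter \<Rightarrow> bool" where
  "add_closed_filter F \<longleftrightarrow>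
    (\<forall>p q. ultrafilter p \<longrightarrow> ultrafilter q \<longrightarrow> p \<le> F \<longrightarrow> q \<le> F \<longrightarrow> filter_add p q \<le> F)"

lemma add_closed_filterD:
  "add_closed_filter F \<Longrightarrow> ultrafilter p \<Longrightarrow> ultrafilter q \<Longrightarrow> p \<le> F \<Longrightarrow> q \<le> F \<Longrightarrow>
    filter_add p q \<le> F"
  by (simp add: add_closed_filter_def)

lemma add_closed_filter_Inf:
  "(\<And>F. F \<in> C \<Longrightarrow> add_closed_filter F) \<Longrightarrow> add_closed_filter (Inf C)"
  by (simp add: add_closed_filter_def le_Inf_iff)

text \<open>Take a minimal closed subsemigroup \<open>M\<close> and \<open>p\<close> in it.
  Minimality gives first \<open>M + p = M\<close>, so some \<open>q\<close> in \<open>M\<close> has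
  \<open>q + p = p\<close>, and then that all of \<open>M\<close>, including \<open>p\<close>
  itself, fixes \<open>p\<close> in this way.\<close>

theorem idempotent_ultrafilter_exists:
  fixes F :: "'a::semigroup_add filter"
  assumes "add_closed_filter F" "F \<noteq> bot"
  obtains p where "ultrafilter p" "p \<le> F" "filter_add p p = p"
proof -
  obtain M where M: "add_closed_filter M" "M \<noteq> bot" "M \<le> F"
    and min: "\<And>G. add_closed_filter G \<Longrightarrow> G \<noteq> bot \<Longrightarrow> G \<le> M \<Longrightarrow> G = M"
    using minimal_filter_exists[of add_closed_filter F] assms add_closed_filter_Inf by metis
  obtain p where p: "ultrafilter p" "p \<le> M"
    using M(2) by (rule ultrafilter_exists_le)
  have "filter_add M p = M"
  proof (rule min)
    show le: "filter_add M p \<le> M"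
    proof (rule filter_le_of_ultrafilters)
      fix r assume "ultrafilter r" "r \<le> filter_add M p"
      then obtain q where "ultrafilter q" "q \<le> M" "filter_add q p = r"
        using p(1) by (blast elim: ultrafilter_le_filter_addE)
      with M(1) p show "r \<le> M" by (metis add_closed_filterD)
    qed
    show "filter_add M p \<noteq> bot"
      using M(2) p(1) by (simp add: filter_add_neq_bot ultrafilter_neq_bot)
    show "add_closed_filter (filter_add M p)"
      unfolding add_closed_filter_def
    proof (intro allI impI)
      fix r s assume rs: "ultrafilter r" "ultrafilter s" "r \<le> filter_add M p" "s \<le> filter_add M p"
      \<comment> \<open>Writing \<open>s\<close> as \<open>q + p\<close> turns \<open>r + s\<close>
        into \<open>(r + q) + p\<close>, where \<open>r + q\<close> lies in
        \<open>M\<close>.\<close>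
      obtain q where q: "ultrafilter q" "q \<le> M" "filter_add q p = s"
        using p(1) rs(2,4) by (rule ultrafilter_le_filter_addE)
      have "filter_add r q \<le> M"
        using M(1) rs(1,3) q le by (meson add_closed_filterD order_trans)
      then have "filter_add (filter_add r q) p \<le> filter_add M p"
        by (rule filter_add_mono) simp
      then show "filter_add r s \<le> filter_add M p"
        by (simp add: filter_add_assoc q(3))
    qed
  qed
  then obtain q where q: "ultrafilter q" "q \<le> M" "filter_add q p = p"
    using p by (metis ultrafilter_le_filter_addE)
  \<comment> \<open>The left side stands for the stabilizer of \<open>p\<close> in \<open>M\<close>;
    it contains \<open>q\<close> and is closed under addition by associativity.\<close>
  have "inf M (filter_diff p p) = M"
  proof (rule min)
    have "q \<le> inf M (filter_diff p p)"
      using q by (simp flip: filter_add_le_iff)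
    then show "inf M (filter_diff p p) \<noteq> bot"
      using ultrafilter_neq_bot[OF q(1)] by (metis bot_unique)
    show "add_closed_filter (inf M (filter_diff p p))"
      unfolding add_closed_filter_def
    proof (intro allI impI)
      fix r s assume rs: "ultrafilter r" "ultrafilter s"
        "r \<le> inf M (filter_diff p p)" "s \<le> inf M (filter_diff p p)"
      then have "filter_add r p \<le> p" "filter_add s p \<le> p"
        by (simp_all add: filter_add_le_iff)
      then have "filter_add (filter_add r s) p \<le> p"
        by (metis filter_add_assoc filter_add_mono order_refl order_trans)
      moreover have "filter_add r s \<le> M"
        using M(1) rs by (simp add: add_closed_filterD)
      ultimately show "filter_add r s \<le> inf M (filter_diff p p)"
        by (simp add: filter_add_le_iff)
    qed
  qed simp
  then have "filter_add p p \<le> p"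
    using p(2) by (metis filter_add_le_iff inf.bounded_iff)
  then have "filter_add p p = p"
    using p(1) by (intro ultrafilter_eq_of_le filter_add_neq_bot ultrafilter_neq_bot)
  with p M(3) show thesis by (intro that) auto
qed

section \<open>Ratios along an idempotent ultrafilter\<close>

lemma idempotent_ultrafilter_pair_pattern:
  assumes p: "ultrafilter p" and idem: "filter_add p p = p"
    and Q: "\<forall>\<^sub>F t in p. \<forall>\<^sub>F v in p. Q t v"
  obtains t v u where "Q t v" "Q v u" "Q t u" "Q t (v + u)"
proof -
  note ne = ultrafilter_neq_bot[OF p]
  obtain t where t: "\<forall>\<^sub>F v in p. Q t v"
    using eventually_happens'[OF ne Q] by blast
  \<comment> \<open>Idempotence splits the good second entries for \<open>t\<close> into sums, so
    \<open>v\<close> can be chosen with \<open>u\<close> still free.\<close>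
  then have "\<forall>\<^sub>F v in p. \<forall>\<^sub>F u in p. Q t (v + u)"
    by (subst (asm) idem[symmetric]) (simp add: eventually_filter_add)
  with Q t have "\<forall>\<^sub>F v in p. Q t v \<and> (\<forall>\<^sub>F u in p. Q v u \<and> Q t (v + u))"
    by eventually_elim (simp add: eventually_conj_iff)
  then obtain v where v: "Q t v" "\<forall>\<^sub>F u in p. Q v u \<and> Q t (v + u)"
    using eventually_happens'[OF ne] by blast
  from v(2) t have "\<forall>\<^sub>F u in p. Q v u \<and> Q t (v + u) \<and> Q t u"
    by eventually_elim simp
  then obtain u where "Q v u" "Q t (v + u)" "Q t u"
    using eventually_happens'[OF ne] by blast
  with v(1) show thesis by (intro that)
qed

lemma add_closed_filter_at_right_0:
  fixes S :: "real set"
  assumes "\<And>x y. x \<in> S \<Longrightarrow> y \<in> S \<Longrightarrow> x + y \<in> S"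
  shows "add_closed_filter (inf (at_right 0) (principal S))"
  unfolding add_closed_filter_def
proof (intro allI impI)
  let ?F = "inf (at_right 0) (principal S)"
  fix p q assume le: "p \<le> ?F" "q \<le> ?F"
  show "filter_add p q \<le> ?F"
  proof (rule filter_leI)
    fix P assume "eventually P ?F"
    then obtain d where d: "d > 0" "\<And>x. 0 < x \<Longrightarrow> x < d \<Longrightarrow> x \<in> S \<Longrightarrow> P x"
      by (auto simp: eventually_inf_principal eventually_at_right_field)
    \<comment> \<open>Halving \<open>d\<close> keeps the sum of two such points below
      \<open>d\<close>.\<close>
    have "eventually (\<lambda>x. 0 < x \<and> x < d / 2 \<and> x \<in> S) ?F"
      using d(1) by (auto simp: eventually_inf_principal eventually_at_right_field
          intro!: exI[of _ "d/2"])
    then have ev: "\<forall>\<^sub>F x in p. 0 < x \<and> x < d / 2 \<and> x \<in> S" "\<forall>\<^sub>F x in q. 0 < x \<and> x < d / 2 \<and> x \<in> S"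
      using le by (blast intro: filter_leD)+
    show "eventually P (filter_add p q)"
      unfolding eventually_filter_add using ev(1)
    proof eventually_elim
      case (elim x)
      from ev(2) show ?case
        by eventually_elim (use elim in \<open>auto intro!: d(2) assms\<close>)
    qed
  qed
qed

theorem theorem3p6:
  fixes S :: "real set" and r :: nat and A :: "nat \<Rightarrow> real set" and \<epsilon> :: real
  assumes "HL_semigroup S"
    and "S = (\<Union>i\<in>{1..r}. A i)"
    and "disjoint_family_on A {1..r}"
    and "\<epsilon> > 0"
  shows "\<exists>a\<in>S. \<exists>b\<in>S. \<exists>k\<in>{1..r}. {a, b, a * b, b * (a + 1)} \<subseteq> A k \<inter> {0<..<\<epsilon>}"
proof -
  let ?F = "inf (at_right 0) (principal S)"
  from assms(1) have pos: "\<And>x. x \<in> S \<Longrightarrow> x > 0"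
    and add: "\<And>x y. x \<in> S \<Longrightarrow> y \<in> S \<Longrightarrow> x + y \<in> S"
    and dense: "{0<..} \<subseteq> closure S"
    and div: "\<And>x y. x \<in> S \<Longrightarrow> y \<in> S \<Longrightarrow> y < 1 \<Longrightarrow> x / y \<in> S"
    unfolding HL_semigroup_def by auto
  have "?F \<noteq> bot"
  proof
    assume "?F = bot"
    then obtain d where d: "d > 0" "\<And>x. 0 < x \<Longrightarrow> x < d \<Longrightarrow> x \<notin> S"
      by (auto simp: trivial_limit_def eventually_inf_principal eventually_at_right_field)
    \<comment> \<open>The ball of radius \<open>d / 2\<close> around this point is exactly the
      interval from 0 to \<open>d\<close>, so density puts a point of \<open>S\<close>
      there.\<close>
    then have "d / 2 \<in> closure S" using dense by auto
    then obtain x where x: "x \<in> S" "dist x (d / 2) < d / 2"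
      using d(1) by (metis closure_approachable half_gt_zero)
    then have "x < d" unfolding dist_real_def by linarith
    with d(2)[of x] pos[of x] x(1) show False by simp
  qed
  with add_closed_filter_at_right_0[OF add]
  obtain p where p: "ultrafilter p" "p \<le> ?F" "filter_add p p = p"
    by (rule idempotent_ultrafilter_exists)
  have small: "\<forall>\<^sub>F x in p. x \<in> S \<and> x < d" if "d > 0" for d
  proof (rule filter_leD[OF p(2)])
    show "\<forall>\<^sub>F x in ?F. x \<in> S \<and> x < d"
      using that by (auto simp: eventually_inf_principal eventually_at_right_field)
  qed
  define Q where "Q k t v \<longleftrightarrow> v / t \<in> A k \<and> v / t < \<epsilon> \<and> t > 0 \<and> v > 0" for k t v
  \<comment> \<open>Requiring \<open>t < 1\<close> makes division by \<open>t\<close> stay in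
    \<open>S\<close>; then \<open>v < \<epsilon> * t\<close> makes the ratio less than
    \<open>\<epsilon>\<close>. Here the colour may still depend on \<open>t\<close>.\<close>
  have "\<forall>\<^sub>F t in p. \<exists>k\<in>{1..r}. \<forall>\<^sub>F v in p. Q k t v"
    using small[of 1, OF zero_less_one]
  proof eventually_elim
    case (elim t)
    then have "\<epsilon> * t > 0" using pos assms(4) by simp
    from small[OF this] have "\<forall>\<^sub>F v in p. \<exists>k\<in>{1..r}. Q k t v"
    proof eventually_elim
      case (elim v)
      moreover have "v / t \<in> S" using div elim \<open>t \<in> S \<and> t < 1\<close> by blast
      ultimately show ?case
        using \<open>t \<in> S \<and> t < 1\<close> pos assms(2) by (auto simp: Q_def field_simps)
    qed
    with p(1) show ?case by (intro ultrafilter_eventually_bex) auto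
  qed
  \<comment> \<open>A second use of finiteness fixes one colour for \<open>p\<close>-many
    \<open>t\<close>.\<close>
  from ultrafilter_eventually_bex[OF p(1) finite_atLeastAtMost this]
  obtain k where k: "k \<in> {1..r}" "\<forall>\<^sub>F t in p. \<forall>\<^sub>F v in p. Q k t v"
    by blast
  obtain t v u where Q: "Q k t v" "Q k v u" "Q k t u" "Q k t (v + u)"
    using p(1,3) k(2) by (rule idempotent_ultrafilter_pair_pattern)
  then have tv: "t > 0" "v > 0" by (auto simp: Q_def)
  then have eq: "u / v * (v / t) = u / t" "v / t * (u / v + 1) = (v + u) / t"
    by (simp_all add: field_simps)
  have "{u / v, v / t, u / v * (v / t), v / t * (u / v + 1)} \<subseteq> A k \<inter> {0<..<\<epsilon>}"
    unfolding eq using Q by (auto simp: Q_def)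
  moreover have "u / v \<in> S" "v / t \<in> S"
    using Q k(1) assms(2) by (auto simp: Q_def)
  ultimately show ?thesis using k(1) by blast
qed

end
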